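(* For every integer $m\ge2$, $R_{C_m}(3,3,\dots,3)=3$ (with $m$ arguments).
   Context: $C_m\le S_m$ denotes the cyclic group generated by the $m$-cycle $(1\,2\,\cdots\,m)$. An $m$-edge-coloured complete graph is a complete graph with each edge coloured from $[m]=\{1,\dots,m\}$. For $\Gamma\le S_m$, $\pi\in\Gamma$ and a vertex $v$, switching at $v$ with $\pi$ recolours every edge incident with $v$ of colour $i$ to colour $\pi(i)$, leaving other edges unchanged. Two such graphs on the same vertex set are $\Gamma$-switch equivalent if one is obtained from the other by a finite sequence of switches. $K_t^{(i)}$ is a complete graph on $t$ vertices with all edges of colour $i$. $R_\Gamma(a_1,\dots,a_m)$ is the least $n$ such that every $m$-edge-coloured complete graph on $n$ vertices is $\Gamma$-switch equivalent to one containing, for some $i$, a copy of $K_{a_i}^{(i)}$. *)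

theory Defs
  imports "HOL-Algebra.Sym_Groups" "HOL-Library.Ramsey" "HOL-Library.FuncSet"
begin

definition cyclic_perms :: "nat \<Rightarrow> (nat \<Rightarrow> nat) set" where
  "cyclic_perms m = generate (sym_group m) {cycle_of_list [1..<m + 1]}"

lemma subgroup_cyclic_perms: "subgroup (cyclic_perms m) (sym_group m)"
proof -
  have "set [1..<m + 1] = {1..m}" by auto
  then have "cycle_of_list [1..<m + 1] permutes {1..m}"
    using cycle_permutes[of "[1..<m + 1]"] by metis
  then show ?thesis
    unfolding cyclic_perms_def
    by (intro group.generate_is_subgroup[OF sym_group_is_group])
       (simp add: sym_group_carrier)
qed

text \<open>
  The edges of the complete graph on \<open>V\<close> are the two-element subsets of \<open>V\<close>.  Colourings are
  extensional functions on these, so that equality of functions is equality of coloured graphs.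
\<close>

definition edge_colourings :: "nat \<Rightarrow> 'a set \<Rightarrow> ('a set \<Rightarrow> nat) set" where
  "edge_colourings m V = (nsets V 2 \<rightarrow>\<^sub>E {1..m})"

definition switch :: "'a set \<Rightarrow> (nat \<Rightarrow> nat) \<Rightarrow> 'a \<Rightarrow> ('a set \<Rightarrow> nat) \<Rightarrow> ('a set \<Rightarrow> nat)" where
  "switch V \<pi> v c = (\<lambda>e \<in> nsets V 2. if v \<in> e then \<pi> (c e) else c e)"

lemma switch_in_edge_colourings:
  assumes "\<pi> \<in> carrier (sym_group m)" "c \<in> edge_colourings m V"
  shows "switch V \<pi> v c \<in> edge_colourings m V"
proof -
  have \<pi>: "\<pi> i \<in> {1..m}" if "i \<in> {1..m}" for i
    using assms(1) that permutes_in_image[of \<pi> "{1..m}" i] by (simp add: sym_group_carrier)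
  have c: "c e \<in> {1..m}" if "e \<in> nsets V 2" for e
    using assms(2) that unfolding edge_colourings_def by (rule PiE_mem)
  show ?thesis
    unfolding edge_colourings_def switch_def
    using \<pi> c by (simp add: restrict_PiE_iff)
qed

definition switch_equivalent ::
  "(nat \<Rightarrow> nat) set \<Rightarrow> 'a set \<Rightarrow> ('a set \<Rightarrow> nat) \<Rightarrow> ('a set \<Rightarrow> nat) \<Rightarrow> bool" where
  "switch_equivalent \<Gamma> V = (\<lambda>c c'. \<exists>\<pi>\<in>\<Gamma>. \<exists>v\<in>V. c' = switch V \<pi> v c)\<^sup>*\<^sup>*"

text \<open>
  The number \<open>m\<close> of colours is the length of the argument list \<open>as\<close>; since colours are counted
  from \<open>1\<close>, the clique size wanted in colour \<open>i\<close> is \<open>as ! (i - 1)\<close>.  The library predicate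
  \<open>monochromatic V k 2 c i\<close> says that some \<open>k\<close>-element subset of \<open>V\<close> has all its
  edges coloured \<open>i\<close> by \<open>c\<close>.  By Ramsey's theorem (using no switches at all) some \<open>n\<close> satisfies
  the condition below, so the least one is well defined.
\<close>

definition switch_ramsey :: "(nat \<Rightarrow> nat) set \<Rightarrow> nat list \<Rightarrow> nat" where
  "switch_ramsey \<Gamma> as =
    (LEAST n. \<forall>V :: nat set. finite V \<and> card V = n \<longrightarrow>
       (\<forall>c \<in> edge_colourings (length as) V.
          \<exists>c'. switch_equivalent \<Gamma> V c c' \<and>
               (\<exists>i \<in> {1..length as}. monochromatic V (as ! (i - 1)) 2 c' i)))"

end

theory Submission
  imports Defs
begin

text \<open>
  Label the edges of a triangle \<open>u, v, w\<close> by \<open>x\<close> on \<open>uv\<close>, \<open>y\<close> on \<open>uw\<close> and \<open>z\<close> on \<open>vw\<close>.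
  Choose powers \<open>\<sigma>, \<tau>\<close> of the cycle with \<open>\<sigma> z = y\<close> and \<open>\<tau> z = x\<close>.  Switching at \<open>v\<close> with
  \<open>\<sigma>\<close> and at \<open>w\<close> with \<open>\<tau>\<close> gives these edges the colours \<open>\<sigma> x = \<sigma> (\<tau> z)\<close>, \<open>\<tau> y = \<tau> (\<sigma> z)\<close> and
  \<open>\<tau> (\<sigma> z)\<close>, which agree because \<open>\<sigma>\<close> and \<open>\<tau>\<close> commute.
\<close>

lemma cycle_funpow_in_cyclic_perms:
  "(cycle_of_list [1..<m + 1] ^^ k) \<in> cyclic_perms m"
proof (induction k)
  case 0
  then show ?case
    using generate.one[of "sym_group m"] by (simp add: cyclic_perms_def sym_group_one id_def)
next
  case (Suc k)
  have "cycle_of_list [1..<m + 1] \<in> cyclic_perms m"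
    unfolding cyclic_perms_def by (rule generate.incl) simp
  from subgroup.m_closed[OF subgroup_cyclic_perms this Suc] show ?case
    by (simp only: sym_group_mult funpow.simps)
qed

text \<open>The \<open>k\<close>-th power of the cycle maps the list \<open>[1..<m + 1]\<close>
  entrywise to its rotation by \<open>k\<close>, so it shifts positions modulo
  \<open>m\<close>.\<close>

lemma cycle_funpow_transitive:
  assumes "a \<in> {1..m}" "b \<in> {1..m}"
  shows "\<exists>k. (cycle_of_list [1..<m + 1] ^^ k) a = b"
proof
  \<comment> \<open>The colour \<open>a\<close> sits at position \<open>a - 1\<close>. The summand
    \<open>m\<close> in \<open>?k\<close> keeps the natural subtraction from truncating when
    \<open>b < a\<close>, and it vanishes modulo \<open>m\<close>.\<close>
  let ?cs = "[1..<m + 1]" and ?k = "b + m - a"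
  have "(cycle_of_list ?cs ^^ ?k) (?cs ! (a - 1)) = map (cycle_of_list ?cs ^^ ?k) ?cs ! (a - 1)"
    using assms by (subst nth_map) auto
  also have "\<dots> = rotate ?k ?cs ! (a - 1)"
    by (subst cyclic_rotation) auto
  also have "\<dots> = ?cs ! ((?k + (a - 1)) mod m)"
    using assms by (subst nth_rotate) auto
  also have "?k + (a - 1) = (b - 1) + m"
    using assms by auto
  also have "((b - 1) + m) mod m = b - 1"
    using assms by (subst mod_add_self2) auto
  also have "?cs ! (b - 1) = b"
    using assms by (simp del: upt_Suc)
  finally show "(cycle_of_list ?cs ^^ ?k) a = b"
    using assms by (simp del: upt_Suc)
qed

lemma switch_equivalent_switch:
  assumes "switch_equivalent \<Gamma> V c c'" "\<pi> \<in> \<Gamma>" "v \<in> V"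
  shows "switch_equivalent \<Gamma> V c (switch V \<pi> v c')"
  using assms unfolding switch_equivalent_def
  by (auto intro: rtranclp.rtrancl_into_rtrancl)

lemma triangle_switch_monochromatic:
  assumes \<Gamma>: "\<Gamma> \<subseteq> carrier (sym_group m)"
    and powers: "\<And>k. f ^^ k \<in> \<Gamma>"
    and trans: "\<And>a b. a \<in> {1..m} \<Longrightarrow> b \<in> {1..m} \<Longrightarrow> \<exists>k. (f ^^ k) a = b"
    and card: "card V = 3" and c: "c \<in> edge_colourings m V"
  shows "\<exists>c'. switch_equivalent \<Gamma> V c c' \<and> (\<exists>i \<in> {1..m}. monochromatic V 3 2 c' i)"
proof -
  obtain u v w where V: "V = {u, v, w}" and ne: "u \<noteq> v" "u \<noteq> w" "v \<noteq> w"
    using card by (auto simp: card_3_iff)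
  have edges: "nsets V 2 = {{u, v}, {u, w}, {v, w}}"
    using ne by (auto simp: V nsets_2_eq)
  have range: "c e \<in> {1..m}" if "e \<in> nsets V 2" for e
    using c that unfolding edge_colourings_def by (rule PiE_mem)
  obtain k where k: "(f ^^ k) (c {v, w}) = c {u, w}"
    using trans[of "c {v, w}" "c {u, w}"] range edges by auto
  obtain l where l: "(f ^^ l) (c {v, w}) = c {u, v}"
    using trans[of "c {v, w}" "c {u, v}"] range edges by auto
  define \<sigma> \<tau> where "\<sigma> = f ^^ k" and "\<tau> = f ^^ l"
  have in_\<Gamma>: "\<sigma> \<in> \<Gamma>" "\<tau> \<in> \<Gamma>"
    using powers by (simp_all add: \<sigma>_def \<tau>_def)
  have \<sigma>: "\<sigma> (c {v, w}) = c {u, w}" and \<tau>: "\<tau> (c {v, w}) = c {u, v}"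
    using k l by (simp_all add: \<sigma>_def \<tau>_def)
  \<comment> \<open>Both composites are \<open>f ^^ (k + l)\<close>.\<close>
  have comm: "\<sigma> (\<tau> j) = \<tau> (\<sigma> j)" for j
    unfolding \<sigma>_def \<tau>_def by (metis add.commute comp_apply funpow_add)
  define c' where "c' = switch V \<tau> w (switch V \<sigma> v c)"
  define i where "i = \<tau> (\<sigma> (c {v, w}))"
  have "switch_equivalent \<Gamma> V c c"
    by (simp add: switch_equivalent_def)
  then have equiv: "switch_equivalent \<Gamma> V c c'"
    using in_\<Gamma> by (auto simp: c'_def V intro!: switch_equivalent_switch)
  \<comment> \<open>The edge \<open>{u, v}\<close> meets only the first switch,
    \<open>{u, w}\<close> only the second, and \<open>{v, w}\<close> both; \<open>comm\<close>
    settles \<open>{u, v}\<close>.\<close>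
  have mono: "c' e = i" if "e \<in> nsets V 2" for e
    using that ne \<sigma> \<tau> comm[of "c {v, w}"]
    by (auto simp: c'_def i_def switch_def edges doubleton_eq_iff)
  \<comment> \<open>Since \<open>i\<close> is the colour of an edge under \<open>c'\<close>, it lies
    in range once \<open>c'\<close> is known to be a colouring.\<close>
  have "c' \<in> edge_colourings m V"
    using c in_\<Gamma> \<Gamma> unfolding c'_def by (intro switch_in_edge_colourings) auto
  then have "c' {u, v} \<in> {1..m}"
    unfolding edge_colourings_def by (rule PiE_mem) (simp add: edges)
  then have i: "i \<in> {1..m}"
    using mono[of "{u, v}"] by (simp add: edges)
  have "V \<in> nsets V 3"
    using card by (simp add: nsets_def card_ge_0_finite)
  with mono have "monochromatic V 3 2 c' i"
    unfolding monochromatic_def by blast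
  with equiv i show ?thesis by blast
qed

lemma not_monochromatic_of_card_less:
  assumes "finite V" "card V < k"
  shows "\<not> monochromatic V k r c i"
  using assms by (simp add: monochromatic_def nsets_eq_empty)

theorem theorem17:
  fixes m :: nat
  assumes "m \<ge> 2"
  shows "switch_ramsey (cyclic_perms m) (replicate m 3) = 3"
  unfolding switch_ramsey_def
proof (rule Least_equality, intro allI impI ballI, elim conjE)
  fix V :: "nat set" and c
  assume "card V = 3" "c \<in> edge_colourings (length (replicate m (3::nat))) V"
  then have "\<exists>c'. switch_equivalent (cyclic_perms m) V c c' \<and>
      (\<exists>i \<in> {1..m}. monochromatic V 3 2 c' i)"
    using subgroup.subset[OF subgroup_cyclic_perms]
    by (intro triangle_switch_monochromatic[where f = "cycle_of_list [1..<m + 1]"]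
          cycle_funpow_in_cyclic_perms cycle_funpow_transitive) simp_all
  moreover have "replicate m (3::nat) ! (i - 1) = 3" if "i \<in> {1..m}" for i
    using that by auto
  ultimately show "\<exists>c'. switch_equivalent (cyclic_perms m) V c c' \<and>
      (\<exists>i \<in> {1..length (replicate m (3::nat))}.
        monochromatic V (replicate m (3::nat) ! (i - 1)) 2 c' i)"
    by (metis length_replicate)
next
  fix n :: nat
  assume *: "\<forall>V :: nat set. finite V \<and> card V = n \<longrightarrow>
    (\<forall>c \<in> edge_colourings (length (replicate m (3::nat))) V.
      \<exists>c'. switch_equivalent (cyclic_perms m) V c c' \<and>
        (\<exists>i \<in> {1..length (replicate m (3::nat))}.
          monochromatic V (replicate m (3::nat) ! (i - 1)) 2 c' i))"
  \<comment> \<open>For the lower bound any colouring serves, here the constant one: whatever the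
    switches do, a monochromatic triangle needs three vertices.\<close>
  have "(\<lambda>e \<in> nsets {..<n} 2. 1) \<in> edge_colourings m {..<n}"
    using assms by (auto simp: edge_colourings_def)
  with * obtain c' i where i: "i \<in> {1..m}"
    and "monochromatic {..<n} (replicate m (3::nat) ! (i - 1)) 2 c' i"
    by (metis card_lessThan finite_lessThan length_replicate)
  moreover have "replicate m (3::nat) ! (i - 1) = 3"
    using i by auto
  ultimately have "monochromatic {..<n} 3 2 c' i"
    by simp
  then show "3 \<le> n"
    using not_monochromatic_of_card_less[of "{..<n}" 3] by (metis card_lessThan finite_lessThan not_less)
qed

end
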